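(* Let $(F_n)_{n\ge 0}$ be the finite Fibonacci strings defined by $F_0=b$, $F_1=a$, $F_n=F_{n-1}F_{n-2}$ for $n\ge 2$. The set of all covers of $F_n$ is: (i) $\{F_n\}$ if $n\in\{0,1,2,3,4\}$; (ii) $\{F_n,F_{n-2},F_{n-4},F_{n-6},\dots,F_3\}$ if $n=2k+1$ with $k\ge 2$; (iii) $\{F_n,F_{n-2},F_{n-4},F_{n-6},\dots,F_4\}$ if $n=2k$ with $k\ge 3$.
   Context: Strings are over the alphabet $\{a,b\}$, where $a$ and $b$ are distinct letters. $|y|$ is the length of a string $y$, and $y[i\ldots j]$ denotes its factor from position $i$ to position $j$ (positions start at 1). A nonempty string $x$ of length $m$ is a cover of a string $y$ of length $n\ge m$ if there is a set of positions $P\subseteq\{1,\dots,n-m+1\}$ such that $y[i\ldots i+m-1]=x$ for all $i\in P$ and $\bigcup_{i\in P}\{i,\dots,i+m-1\}=\{1,\dots,n\}$. In particular $y$ is a cover of itself. *)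

theory Defs
  imports Main
begin

datatype letter = LetA | LetB

type_synonym lstring = "letter list"

fun fib_string :: "nat \<Rightarrow> lstring" where
  "fib_string 0 = [LetB]"
| "fib_string (Suc 0) = [LetA]"
| "fib_string (Suc (Suc n)) = fib_string (Suc n) @ fib_string n"

text \<open>The factor of \<open>y\<close> from position \<open>i\<close> to position \<open>j\<close>, both inclusive; positions start at 1.\<close>

definition factor :: "'a list \<Rightarrow> nat \<Rightarrow> nat \<Rightarrow> 'a list" where
  "factor y i j = take (j + 1 - i) (drop (i - 1) y)"

text \<open>The bound \<open>length x \<le> length y\<close> comes first, so the natural-number subtractions below
  do not truncate.\<close>

definition is_cover :: "'a list \<Rightarrow> 'a list \<Rightarrow> bool" where
  "is_cover x y \<longleftrightarrow>
     x \<noteq> [] \<and> length x \<le> length y \<and>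
     (\<exists>P. P \<subseteq> {1..length y - length x + 1} \<and>
          (\<forall>i\<in>P. factor y i (i + length x - 1) = x) \<and>
          (\<Union>i\<in>P. {i..i + length x - 1}) = {1..length y})"

end

theory Submission
  imports Defs "HOL-Library.Sublist"
begin

text \<open>
  A cover of \<open>y\<close> is a border of \<open>y\<close>, i.e. both a prefix and a suffix. The borders of \<open>F\<^sub>n\<close> are
  exactly \<open>F\<^sub>n, F\<^bsub>n-2\<^esub>, F\<^bsub>n-4\<^esub>, \<dots>\<close> down to index 1 or 2: a border no longer than \<open>F\<^bsub>n-2\<^esub>\<close> is a border
  of \<open>F\<^bsub>n-2\<^esub>\<close>, and a longer proper border has the form \<open>w F\<^bsub>n-2\<^esub>\<close> with \<open>w\<close> a proper border of
  \<open>F\<^bsub>n-1\<^esub>\<close>, so by induction \<open>w = F\<^sub>j\<close> with \<open>n - 1 - j\<close> even, and the border also equals \<open>F\<^bsub>n-2\<^esub> F\<^sub>j\<close>;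
  but \<open>F\<^sub>j\<close> and \<open>F\<^bsub>n-2\<^esub>\<close> end in different letters. Finally \<open>F\<^sub>1\<close> and \<open>F\<^sub>2\<close> are too short to cover
  longer Fibonacci strings, while for \<open>n \<ge> 5\<close> the string \<open>F\<^bsub>n-2\<^esub>\<close> covers
  \<open>F\<^sub>n = F\<^bsub>n-2\<^esub> F\<^bsub>n-2\<^esub> F\<^bsub>n-5\<^esub> F\<^bsub>n-4\<^esub> = F\<^bsub>n-1\<^esub> F\<^bsub>n-2\<^esub>\<close>.
\<close>

section \<open>Covers as occurrences counted from 0\<close>

lemma factor_eq_iff_prefix_drop:
  assumes "x \<noteq> []"
  shows "factor y (Suc i) (Suc i + length x - 1) = x \<longleftrightarrow> prefix x (drop i y)"
  by (metis Suc_eq_plus1 add.commute add_diff_cancel_left' add_diff_cancel_right' assms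
      factor_def le_add_diff_inverse length_0_conv less_one not_le plus_1_eq_Suc prefix_def
      take_is_prefix append_eq_conv_conj add_Suc_right)

text \<open>The position set disappears because it may always be enlarged to all occurrences of
  \<open>x\<close>; what remains is a condition on each single position, now counted from 0.\<close>

lemma is_cover_iff:
  "is_cover x y \<longleftrightarrow> x \<noteq> [] \<and> length x \<le> length y \<and>
     (\<forall>k<length y. \<exists>i\<le>k. k < i + length x \<and> prefix x (drop i y))"
  (is "_ \<longleftrightarrow> ?R")
proof
  assume "is_cover x y"
  then obtain P where x: "x \<noteq> []" "length x \<le> length y"
    and P: "P \<subseteq> {1..length y - length x + 1}"
      "\<And>i. i \<in> P \<Longrightarrow> factor y i (i + length x - 1) = x"
      "(\<Union>i\<in>P. {i..i + length x - 1}) = {1..length y}"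
    unfolding is_cover_def by blast
  have "\<exists>i\<le>k. k < i + length x \<and> prefix x (drop i y)" if "k < length y" for k
  proof -
    have "Suc k \<in> {1..length y}" using that by simp
    then obtain i where i: "i \<in> P" "i \<le> Suc k" "Suc k \<le> i + length x - 1"
      unfolding P(3)[symmetric] by auto
    moreover obtain i' where "i = Suc i'" using i(1) P(1) by (cases i) auto
    ultimately show ?thesis using P(2)[OF i(1)] factor_eq_iff_prefix_drop[OF x(1), of y i']
      by (intro exI[of _ i']) auto
  qed
  with x show ?R by blast
next
  assume R: ?R
  define P where "P = {Suc i |i. i < length y \<and> prefix x (drop i y)}"
  have len: "i + length x \<le> length y" if "prefix x (drop i y)" "i < length y" for i
    using prefix_length_le[OF that(1)] that(2) by simp
  have "P \<subseteq> {1..length y - length x + 1}"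
    using len by (fastforce simp: P_def)
  moreover have "\<forall>i\<in>P. factor y i (i + length x - 1) = x"
  proof
    fix i assume "i \<in> P"
    then obtain i' where "i = Suc i'" "prefix x (drop i' y)" by (auto simp: P_def)
    then show "factor y i (i + length x - 1) = x"
      using R factor_eq_iff_prefix_drop by blast
  qed
  moreover have "(\<Union>i\<in>P. {i..i + length x - 1}) = {1..length y}"
  proof
    show "(\<Union>i\<in>P. {i..i + length x - 1}) \<subseteq> {1..length y}"
      using len by (fastforce simp: P_def)
    show "{1..length y} \<subseteq> (\<Union>i\<in>P. {i..i + length x - 1})"
    proof
      fix k assume "k \<in> {1..length y}"
      then obtain k' where k': "k = Suc k'" "k' < length y" by (cases k) auto
      with R obtain i where "i \<le> k'" "k' < i + length x" "prefix x (drop i y)" by blast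
      with k' have "Suc i \<in> P" "k \<in> {Suc i..Suc i + length x - 1}" by (auto simp: P_def)
      then show "k \<in> (\<Union>i\<in>P. {i..i + length x - 1})" by blast
    qed
  qed
  ultimately show "is_cover x y" using R unfolding is_cover_def by blast
qed

lemma is_cover_refl: "x \<noteq> [] \<Longrightarrow> is_cover x x"
  unfolding is_cover_iff by (auto intro!: exI[of _ 0])

text \<open>An occurrence of \<open>y\<close> at \<open>i\<close> in \<open>z\<close> carries an
  occurrence of \<open>x\<close> at \<open>j\<close> in \<open>y\<close> to one at
  \<open>i + j\<close> in \<open>z\<close>.\<close>

lemma is_cover_trans:
  assumes "is_cover x y" "is_cover y z"
  shows "is_cover x z"
  unfolding is_cover_iff
proof (intro conjI allI impI)
  show "x \<noteq> []" "length x \<le> length z" using assms unfolding is_cover_iff by auto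
  fix k assume "k < length z"
  with assms obtain i where i: "i \<le> k" "k < i + length y" "prefix y (drop i z)"
    unfolding is_cover_iff by blast
  then have "k - i < length y" by simp
  with assms obtain j where j: "j \<le> k - i" "k - i < j + length x" "prefix x (drop j y)"
    unfolding is_cover_iff by blast
  from i(3) obtain u where "drop i z = y @ u" by (auto simp: prefix_def)
  then have "drop (i + j) z = drop j y @ drop (j - length y) u"
    by (metis add.commute drop_append drop_drop)
  then have "prefix x (drop (i + j) z)" using j(3) by (simp add: prefix_prefix)
  with i j show "\<exists>i\<le>k. k < i + length x \<and> prefix x (drop i z)"
    by (intro exI[of _ "i + j"]) auto
qed

text \<open>Position 0 can only be covered by an occurrence that starts there.\<close>

lemma is_cover_imp_prefix: "is_cover x y \<Longrightarrow> prefix x y"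
  unfolding is_cover_iff by (metis drop_0 le_zero_eq length_greater_0_conv less_le_trans)

lemma is_cover_imp_suffix:
  assumes "is_cover x y"
  shows "suffix x y"
proof -
  have "length y - 1 < length y" using assms unfolding is_cover_iff
    by (cases y) auto
  with assms obtain i where i: "i \<le> length y - 1" "length y - 1 < i + length x"
    "prefix x (drop i y)" unfolding is_cover_iff by blast
  \<comment> \<open>An occurrence reaching the last position leaves nothing of \<open>y\<close>
    behind it, so \<open>x\<close> is all of \<open>drop i y\<close>.\<close>
  then have "length (drop i y) \<le> length x" by auto
  with i(3) have "x = drop i y"
    by (metis prefix_length_le prefix_def append_eq_conv_conj le_antisym take_all)
  then show ?thesis by (simp add: suffix_drop)
qed

section \<open>Borders of Fibonacci strings\<close>

lemma fib_string_nonempty [simp]: "fib_string n \<noteq> []"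
  by (induction n rule: fib_string.induct) auto

lemma last_fib_string: "last (fib_string n) = (if even n then LetB else LetA)"
  by (induction n rule: fib_string.induct) auto

lemma length_fib_string_Suc: "length (fib_string n) \<le> length (fib_string (Suc n))"
  by (cases n) auto

lemma prefix_fib_string:
  assumes "1 \<le> m" "m \<le> n"
  shows "prefix (fib_string m) (fib_string n)"
  using assms(2)
proof (induction n rule: dec_induct)
  case (step n)
  then obtain n' where "n = Suc n'" using assms(1) by (cases n) auto
  then have "prefix (fib_string n) (fib_string (Suc n))" by simp
  with step show ?case using prefix_order.trans by blast
qed simp

text \<open>The clause on \<open>m = 0\<close> reflects that \<open>[LetB]\<close> is a suffix of
  every string of even index but a prefix of \<open>fib_string 0\<close> alone. The induction relies
  on it, since \<open>prefix_fib_string\<close> starts at index 1.\<close>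

lemma fib_string_border:
  assumes "prefix x (fib_string n)" "suffix x (fib_string n)" "x \<noteq> []"
  shows "\<exists>m. m \<le> n \<and> even (n - m) \<and> x = fib_string m \<and> (m = 0 \<longrightarrow> n = 0)"
  using assms
proof (induction n arbitrary: x rule: less_induct)
  case (less n)
  show ?case
  proof (cases "n < 2 \<or> x = fib_string n")
    case True
    then consider "n = 0" | "n = 1" | "x = fib_string n" by linarith
    then show ?thesis using less.prems
      by cases (auto simp: prefix_Cons intro: exI[of _ n])
  next
    case False
    then obtain q where n: "n = Suc (Suc q)"
      by (metis add_2_eq_Suc le_add_diff_inverse not_less)
    have fn: "fib_string n = fib_string (Suc q) @ fib_string q" by (simp add: n)
    show ?thesis
    proof (cases "length x \<le> length (fib_string q)")
      case True
      have suf: "suffix x (fib_string q)"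
        using less.prems(2) True unfolding fn
        by (metis suffix_appendI suffix_length_suffix suffix_order.refl)
      show ?thesis
      proof (cases q)
        case 0
        \<comment> \<open>Here \<open>n = 2\<close>, and the string begins with
          \<open>LetA\<close>.\<close>
        with suf less.prems(3) have "x = [LetB]"
          by (simp add: suffix_Cons)
        with less.prems(1) show ?thesis by (simp add: fn 0)
      next
        case (Suc q')
        then have "prefix (fib_string q) (fib_string n)"
          by (intro prefix_fib_string) (auto simp: n)
        then have "prefix x (fib_string q)"
          using less.prems(1) True prefix_length_prefix by blast
        from less.IH[OF _ this suf less.prems(3)] Suc n show ?thesis
          by (metis Suc_diff_le even_Suc le_Suc_eq lessI less_SucI nat.distinct(1))
      qed
    next
      case False2: False
      with less.prems(2) obtain w where w: "x = w @ fib_string q" "suffix w (fib_string (Suc q))"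
        unfolding fn suffix_append using suffix_length_le by blast
      have "w \<noteq> []" using False2 w by auto
      have lw: "length w \<le> length (fib_string (Suc q))" using w(2) suffix_length_le by blast
      have "prefix w (fib_string n)" using less.prems(1) w(1) append_prefixD by blast
      then have pw: "prefix w (fib_string (Suc q))"
        using lw unfolding fn by (metis prefix_length_prefix prefixI)
      have wne: "w \<noteq> fib_string (Suc q)" using False w(1) fn by auto
      from less.IH[OF _ pw w(2) \<open>w \<noteq> []\<close>] obtain j where
        j: "j \<le> Suc q" "even (Suc q - j)" "w = fib_string j" "j \<noteq> 0" by (auto simp: n)
      \<comment> \<open>Parity excludes \<open>j = q\<close>; hence \<open>j\<close> is at most
        \<open>q - 1\<close>, the index \<open>r\<close> below.\<close>
      with wne have "j \<noteq> Suc q" "j \<noteq> q" by auto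
      with j have jq: "Suc j \<le> q" by auto
      then obtain r where q: "q = Suc r" using j by (cases q) auto
      \<comment> \<open>Unfolding the first factor once more puts \<open>fib_string q\<close> in
        front, followed by a string that has \<open>fib_string j\<close> as a prefix. Comparing
        lengths gives \<open>x\<close> a second factorization, with the two factors swapped.\<close>
      have fn2: "fib_string n = fib_string q @ fib_string r @ fib_string q"
        by (simp add: fn q)
      have "prefix (fib_string j) (fib_string r)"
        using jq j q by (intro prefix_fib_string) auto
      then have "prefix (fib_string q @ fib_string j) (fib_string n)"
        unfolding fn2 by (simp add: prefix_prefix)
      moreover have "length x = length (fib_string q @ fib_string j)" by (simp add: w(1) j(3))
      ultimately have "x = fib_string q @ fib_string j"
        using less.prems(1) by (metis append_eq_conv_conj prefix_def)
      \<comment> \<open>The two factorizations of \<open>x\<close> end in these strings, yet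
        \<open>j\<close> has the parity of \<open>Suc q\<close>, not of \<open>q\<close>.\<close>
      then have "last (fib_string q) = last (fib_string j)"
        using w(1) by (metis fib_string_nonempty last_appendR)
      with j(1,2) show ?thesis
        by (auto simp: last_fib_string split: if_splits)
    qed
  qed
qed

section \<open>Which borders are covers\<close>

lemma is_cover_fib_string_step: "is_cover (fib_string (n + 3)) (fib_string (n + 5))"
proof -
  let ?F = fib_string
  let ?x = "?F (n + 3)" and ?y = "?F (n + 5)"
  have x: "?x = ?F (Suc n) @ ?F n @ ?F (Suc n)"
    by (simp add: numeral_eq_Suc)
  \<comment> \<open>\<open>y1\<close> shows two adjacent occurrences at the start, \<open>y2\<close>
    one at the end. The last begins no later than the second ends, because \<open>?F (n + 2)\<close>
    is no longer than \<open>?x\<close>.\<close>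
  have y1: "?y = ?x @ ?x @ ?F n @ ?F (Suc n)"
    and y2: "?y = (?x @ ?F (n + 2)) @ ?x"
    by (simp_all add: numeral_eq_Suc)
  have len: "length (?F (n + 2)) \<le> length ?x"
    using length_fib_string_Suc[of "n + 2"] by (simp add: numeral_eq_Suc)
  have ly: "length ?y = 2 * length ?x + length (?F (n + 2))"
    unfolding y2 by simp
  have occ: "prefix ?x (drop 0 ?y)" "prefix ?x (drop (length ?x) ?y)"
    "prefix ?x (drop (length ?x + length (?F (n + 2))) ?y)"
    subgoal unfolding y1 by simp
    subgoal unfolding y1 by simp
    subgoal unfolding y2 by (simp del: append_assoc)
    done
  show ?thesis
    unfolding is_cover_iff
  proof (intro conjI allI impI)
    fix k assume k: "k < length ?y"
    consider "k < length ?x" | "length ?x \<le> k" "k < length ?x + length ?x"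
      | "length ?x + length ?x \<le> k" by linarith
    then show "\<exists>i\<le>k. k < i + length ?x \<and> prefix ?x (drop i ?y)"
    proof cases
      case 1
      with occ(1) show ?thesis by (intro exI[of _ 0]) simp
    next
      case 2
      with occ(2) show ?thesis by blast
    next
      case 3
      with occ(3) len ly k show ?thesis
        by (intro exI[of _ "length ?x + length (?F (n + 2))"]) linarith
    qed
  qed (use ly in simp_all)
qed

lemma is_cover_fib_string:
  assumes "3 \<le> m"
  shows "is_cover (fib_string m) (fib_string (m + 2 * d))"
proof (induction d)
  case (Suc d)
  have "is_cover (fib_string (m + 2 * d)) (fib_string (m + 2 * Suc d))"
  proof -
    define n where "n = m + 2 * d - 3"
    with assms have "m + 2 * d = n + 3" "m + 2 * Suc d = n + 5" by auto
    then show ?thesis using is_cover_fib_string_step[of n] by metis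
  qed
  with Suc show ?case using is_cover_trans by blast
qed (simp add: is_cover_refl)

text \<open>The second letter is \<open>LetB\<close>, which no occurrence of \<open>[LetA]\<close>
  covers.\<close>

lemma not_is_cover_fib_string_1:
  assumes "2 \<le> n"
  shows "\<not> is_cover (fib_string 1) (fib_string n)"
proof
  assume c: "is_cover (fib_string 1) (fib_string n)"
  have "prefix (fib_string 2) (fib_string n)" using assms by (intro prefix_fib_string) auto
  then obtain u where u: "fib_string n = LetA # LetB # u"
    by (auto simp: prefix_def numeral_eq_Suc)
  with c have "\<exists>i\<le>1. 1 < i + 1 \<and> prefix [LetA] (drop i (LetA # LetB # u))"
    unfolding is_cover_iff by (auto dest!: spec[of _ 1])
  then show False by (auto simp: le_Suc_eq)
qed

text \<open>The string begins with abaab. An occurrence of ab covering its third letter would start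
  at the second or third, where ba and aa stand.\<close>

lemma not_is_cover_fib_string_2:
  assumes "4 \<le> n"
  shows "\<not> is_cover (fib_string 2) (fib_string n)"
proof
  assume c: "is_cover (fib_string 2) (fib_string n)"
  have "prefix (fib_string 4) (fib_string n)" using assms by (intro prefix_fib_string) auto
  then obtain u where u: "fib_string n = LetA # LetB # LetA # LetA # LetB # u"
    by (auto simp: prefix_def numeral_eq_Suc)
  with c have "\<exists>i\<le>2. 2 < i + 2 \<and> prefix [LetA, LetB] (drop i (LetA # LetB # LetA # LetA # LetB # u))"
    unfolding is_cover_iff by (auto dest!: spec[of _ 2] simp: numeral_eq_Suc)
  then show False by (auto simp: le_Suc_eq numeral_eq_Suc)
qed

lemma is_cover_fib_string_iff:
  "is_cover x (fib_string n) \<longleftrightarrow>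
     (\<exists>m\<le>n. even (n - m) \<and> (m = n \<or> 3 \<le> m) \<and> x = fib_string m)"
proof
  assume c: "is_cover x (fib_string n)"
  then have "x \<noteq> []" by (simp add: is_cover_def)
  with c obtain m where m: "m \<le> n" "even (n - m)" "x = fib_string m" "m = 0 \<longrightarrow> n = 0"
    using fib_string_border is_cover_imp_prefix is_cover_imp_suffix by blast
  have "m = n \<or> 3 \<le> m"
  proof (rule ccontr)
    assume "\<not> (m = n \<or> 3 \<le> m)"
    with m have "m = 1 \<and> 2 \<le> n \<or> m = 2 \<and> 3 \<le> n" by auto
    \<comment> \<open>Parity raises the bound for \<open>m = 2\<close> to \<open>4 \<le> n\<close>,
      where the non-cover lemma applies.\<close>
    moreover have "m \<noteq> 2 \<or> n \<noteq> 3" using m(2) by auto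
    ultimately show False
      using c m(3) not_is_cover_fib_string_1[of n] not_is_cover_fib_string_2[of n] by fastforce
  qed
  with m show "\<exists>m\<le>n. even (n - m) \<and> (m = n \<or> 3 \<le> m) \<and> x = fib_string m" by blast
next
  assume "\<exists>m\<le>n. even (n - m) \<and> (m = n \<or> 3 \<le> m) \<and> x = fib_string m"
  then obtain m d where "x = fib_string m" "m = n \<or> 3 \<le> m" "n = m + 2 * d"
    by (metis evenE ordered_cancel_comm_monoid_diff_class.add_diff_inverse)
  then show "is_cover x (fib_string n)"
    by (metis fib_string_nonempty is_cover_fib_string is_cover_refl)
qed

theorem theorem1:
  shows "(\<forall>n. n \<in> {0, 1, 2, 3, 4} \<longrightarrow>
            {x. is_cover x (fib_string n)} = {fib_string n}) \<and>
         (\<forall>n k. n = 2 * k + 1 \<and> 2 \<le> k \<longrightarrow>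
            {x. is_cover x (fib_string n)} = {fib_string (2 * j + 1) |j. 1 \<le> j \<and> j \<le> k}) \<and>
         (\<forall>n k. n = 2 * k \<and> 3 \<le> k \<longrightarrow>
            {x. is_cover x (fib_string n)} = {fib_string (2 * j) |j. 2 \<le> j \<and> j \<le> k})"
proof (intro conjI allI impI)
  fix n :: nat
  assume n: "n \<in> {0, 1, 2, 3, 4}"
  have "m = n" if "m \<le> n" "even (n - m)" "m = n \<or> 3 \<le> m" for m
  proof (rule ccontr)
    assume "m \<noteq> n"
    \<comment> \<open>The only smaller index that is at least 3 has the wrong parity.\<close>
    with that n have "m = 3" "n = 4" by auto
    with that show False by simp
  qed
  then show "{x. is_cover x (fib_string n)} = {fib_string n}"
    by (auto simp: is_cover_fib_string_iff)
next
  fix n k :: nat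
  assume n: "n = 2 * k + 1 \<and> 2 \<le> k"
  have "(m \<le> n \<and> even (n - m) \<and> (m = n \<or> 3 \<le> m)) \<longleftrightarrow> (\<exists>j. m = 2 * j + 1 \<and> 1 \<le> j \<and> j \<le> k)" for m
    using n by presburger
  then show "{x. is_cover x (fib_string n)} = {fib_string (2 * j + 1) |j. 1 \<le> j \<and> j \<le> k}"
    unfolding is_cover_fib_string_iff by (intro Collect_cong) metis
next
  fix n k :: nat
  assume n: "n = 2 * k \<and> 3 \<le> k"
  have "(m \<le> n \<and> even (n - m) \<and> (m = n \<or> 3 \<le> m)) \<longleftrightarrow> (\<exists>j. m = 2 * j \<and> 2 \<le> j \<and> j \<le> k)" for m
    using n by presburger
  then show "{x. is_cover x (fib_string n)} = {fib_string (2 * j) |j. 2 \<le> j \<and> j \<le> k}"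
    unfolding is_cover_fib_string_iff by (intro Collect_cong) metis
qed

end
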